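(* Let $f:\mathbb{R}\to\mathbb{R}$ and $x\in\mathbb{R}$. (1) For each $\beta>0$: if $\upsilon^{\beta}_{+}f(x)$ exists finitely, then $f$ is right-Hölder continuous of order $\beta$ at $x$; and if $\upsilon^{\beta}_{-}f(x)$ exists finitely, then $f$ is left-Hölder continuous of order $\beta$ at $x$. (2) Conversely, let $0<\beta\le 1$ and fix one of the signs $\pm$. If the Hölder growth condition and the Hölder oscillation condition (both for this sign and of order $\beta$ at $x$) hold, then $\upsilon^{\beta}_{\pm}f(x)$ exists (finitely). (3) Moreover, for $0<\beta\le 1$ and each choice of sign, the Hölder oscillation condition is a necessary and sufficient condition for the (finite) existence of $\upsilon^{\beta}_{\pm}f(x)$, and the Hölder growth condition is a necessary condition for the (finite) existence of $\upsilon^{\beta}_{\pm}f(x)$.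
   Context: For $\epsilon>0$ put $\Delta^{+}_{\epsilon}[f](x)=f(x+\epsilon)-f(x)$, $\Delta^{-}_{\epsilon}[f](x)=f(x)-f(x-\epsilon)$, and define the fractal variations $\upsilon_{\beta}^{\epsilon\pm}[f](x)=\Delta^{\pm}_{\epsilon}[f](x)/\epsilon^{\beta}$. The fractional velocity of order $\beta$ is $\upsilon^{\beta}_{\pm}f(x)=\lim_{\epsilon\to0^+}\upsilon_{\beta}^{\epsilon\pm}[f](x)$. $f$ is right- (left-) Hölder continuous of order $\beta$ at $x$ if there are constants $C,\delta>0$ with $|f(x+\epsilon)-f(x)|\le C\epsilon^{\beta}$ (respectively $|f(x)-f(x-\epsilon)|\le C\epsilon^\beta$) for all $0<\epsilon\le\delta$. Oscillation: $\mathrm{osc}^{+}_{\epsilon}[f](x)=\sup_{[x,x+\epsilon]}f-\inf_{[x,x+\epsilon]}f$ and $\mathrm{osc}^{-}_{\epsilon}[f](x)=\sup_{[x-\epsilon,x]}f-\inf_{[x-\epsilon,x]}f$. Hölder growth condition (order $\beta$, sign $\pm$, at $x$): there is a constant $C\ge0$ such that $\mathrm{osc}^{\pm}_{\epsilon}[f](x)\le C\epsilon^{\beta}$ for all sufficiently small $\epsilon>0$. Hölder oscillation condition (order $\beta$, sign $\pm$, at $x$): $\lim_{\epsilon\to0^+}\left(\sup_{0<\eta\le\epsilon}\upsilon_{\beta}^{\eta\pm}[f](x)-\inf_{0<\eta\le\epsilon}\upsilon_{\beta}^{\eta\pm}[f](x)\right)=0$, i.e. the oscillation of the fractal variation, as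 a function of the increment, vanishes as the increment tends to $0$. *)

theory Defs
  imports Complex_Main "HOL-Library.Extended_Real"
begin

datatype side = Plus | Minus

fun incr :: "side \<Rightarrow> real \<Rightarrow> (real \<Rightarrow> real) \<Rightarrow> real \<Rightarrow> real" where
  "incr Plus \<epsilon> f x = f (x + \<epsilon>) - f x"
| "incr Minus \<epsilon> f x = f x - f (x - \<epsilon>)"

definition frac_variation :: "side \<Rightarrow> real \<Rightarrow> real \<Rightarrow> (real \<Rightarrow> real) \<Rightarrow> real \<Rightarrow> real" where
  "frac_variation s \<beta> \<epsilon> f x = incr s \<epsilon> f x / \<epsilon> powr \<beta>"

definition has_frac_velocity :: "side \<Rightarrow> real \<Rightarrow> (real \<Rightarrow> real) \<Rightarrow> real \<Rightarrow> real \<Rightarrow> bool" where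
  "has_frac_velocity s \<beta> f x L \<longleftrightarrow> ((\<lambda>\<epsilon>. frac_variation s \<beta> \<epsilon> f x) \<longlongrightarrow> L) (at_right 0)"

definition frac_velocity_exists :: "side \<Rightarrow> real \<Rightarrow> (real \<Rightarrow> real) \<Rightarrow> real \<Rightarrow> bool" where
  "frac_velocity_exists s \<beta> f x \<longleftrightarrow> (\<exists>L::real. has_frac_velocity s \<beta> f x L)"

definition holder_continuous_at :: "side \<Rightarrow> real \<Rightarrow> (real \<Rightarrow> real) \<Rightarrow> real \<Rightarrow> bool" where
  "holder_continuous_at s \<beta> f x \<longleftrightarrow>
     (\<exists>C>0. \<exists>\<delta>>0. \<forall>\<epsilon>. 0 < \<epsilon> \<and> \<epsilon> \<le> \<delta> \<longrightarrow> \<bar>incr s \<epsilon> f x\<bar> \<le> C * \<epsilon> powr \<beta>)"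

(* Suprema and infima are taken in the extended reals, because f need not be locally
   bounded and Sup is unspecified on unbounded sets of reals. On a nonempty set S the
   difference below is never of the form \<infinity> - \<infinity>; it is \<infinity> exactly when g is unbounded on S. *)
definition oscillation_on :: "real set \<Rightarrow> (real \<Rightarrow> real) \<Rightarrow> ereal" where
  "oscillation_on S g = (SUP y\<in>S. ereal (g y)) - (INF y\<in>S. ereal (g y))"

fun osc :: "side \<Rightarrow> real \<Rightarrow> (real \<Rightarrow> real) \<Rightarrow> real \<Rightarrow> ereal" where
  "osc Plus \<epsilon> f x = oscillation_on {x..x + \<epsilon>} f"
| "osc Minus \<epsilon> f x = oscillation_on {x - \<epsilon>..x} f"

definition holder_growth_condition :: "side \<Rightarrow> real \<Rightarrow> (real \<Rightarrow> real) \<Rightarrow> real \<Rightarrow> bool" where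
  "holder_growth_condition s \<beta> f x \<longleftrightarrow>
     (\<exists>C\<ge>0. \<forall>\<^sub>F \<epsilon> in at_right 0. osc s \<epsilon> f x \<le> ereal (C * \<epsilon> powr \<beta>))"

definition holder_oscillation_condition :: "side \<Rightarrow> real \<Rightarrow> (real \<Rightarrow> real) \<Rightarrow> real \<Rightarrow> bool" where
  "holder_oscillation_condition s \<beta> f x \<longleftrightarrow>
     ((\<lambda>\<epsilon>. oscillation_on {0<..\<epsilon>} (\<lambda>\<eta>. frac_variation s \<beta> \<eta> f x)) \<longlongrightarrow> 0) (at_right 0)"

end

theory Submission
  imports Defs
begin

text \<open>The oscillation condition is Cauchy's criterion for the convergence of the fractal variation
  at \<open>0+\<close>, and a convergent fractal variation is bounded near \<open>0\<close>, which is the Hoelder estimate;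
  the growth condition follows because \<open>\<epsilon> powr \<beta>\<close> is increasing in \<open>\<epsilon>\<close>.\<close>

text \<open>For fixed \<open>z\<close> the hypothesis bounds the supremum by \<open>c + g z\<close>;
  letting \<open>z\<close> vary, this becomes a lower bound for the infimum.\<close>

lemma oscillation_on_upper:
  assumes "S \<noteq> {}" and le: "\<And>y z. y \<in> S \<Longrightarrow> z \<in> S \<Longrightarrow> g y - g z \<le> c"
  shows "oscillation_on S g \<le> ereal c"
proof -
  obtain z0 where z0: "z0 \<in> S" using assms(1) by blast
  have SUP_le: "(SUP y\<in>S. ereal (g y)) \<le> ereal (c + g z)" if "z \<in> S" for z
    by (rule SUP_least) (use le[OF _ that] in \<open>simp add: algebra_simps\<close>)
  have "ereal (g z0) \<le> (SUP y\<in>S. ereal (g y))"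
    using z0 by (rule SUP_upper)
  \<comment> \<open>Being squeezed between the reals \<open>g z0\<close> and
    \<open>c + g z0\<close>, the supremum is itself real, so it can be moved across inequalities as
    in ordinary arithmetic.\<close>
  with SUP_le[OF z0] obtain M where M: "(SUP y\<in>S. ereal (g y)) = ereal M"
    by (cases "SUP y\<in>S. ereal (g y)") auto
  have "ereal (M - c) \<le> (INF y\<in>S. ereal (g y))"
    by (rule INF_greatest) (use SUP_le M in \<open>force simp: algebra_simps\<close>)
  then have "oscillation_on S g \<le> ereal M - ereal (M - c)"
    unfolding oscillation_on_def M by (intro ereal_minus_mono) auto
  then show ?thesis by simp
qed

lemma oscillation_on_lower:
  assumes "y \<in> S" "z \<in> S"
  shows "ereal (g y - g z) \<le> oscillation_on S g"
proof -
  have "ereal (g y) - ereal (g z) \<le> oscillation_on S g"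
    unfolding oscillation_on_def
    by (intro ereal_minus_mono SUP_upper INF_lower assms)
  then show ?thesis by simp
qed

text \<open>The oscillation on \<open>{0<..\<epsilon>}\<close> is the least upper bound of the
  differences \<open>g y - g z\<close>, so its vanishing is the Cauchy property of \<open>g\<close>
  along \<open>at_right 0\<close>. Completeness of the reals then supplies the limit.\<close>

lemma convergent_at_right_0_iff_oscillation:
  fixes g :: "real \<Rightarrow> real"
  shows "(\<exists>L. (g \<longlongrightarrow> L) (at_right 0)) \<longleftrightarrow>
    ((\<lambda>\<epsilon>. oscillation_on {0<..\<epsilon>} g) \<longlongrightarrow> 0) (at_right 0)"
proof
  assume "\<exists>L. (g \<longlongrightarrow> L) (at_right 0)"
  then obtain L where L: "(g \<longlongrightarrow> L) (at_right 0)" by blast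
  show "((\<lambda>\<epsilon>. oscillation_on {0<..\<epsilon>} g) \<longlongrightarrow> 0) (at_right 0)"
  proof (rule order_tendstoI)
    fix a :: ereal assume a: "a < 0"
    \<comment> \<open>Comparing the point \<epsilon> with itself shows that the oscillation is
      nonnegative.\<close>
    have "a < oscillation_on {0<..\<epsilon>} g" if "\<epsilon> > 0" for \<epsilon>
      using oscillation_on_lower[of \<epsilon> "{0<..\<epsilon>}" \<epsilon> g] that a by (simp add: zero_ereal_def)
    then show "\<forall>\<^sub>F \<epsilon> in at_right 0. a < oscillation_on {0<..\<epsilon>} g"
      by (auto simp: eventually_at_right_field intro: exI[of _ 1])
  next
    fix a :: ereal assume "0 < a"
    \<comment> \<open>The bound \<open>a\<close> may be infinite, while the estimate of
      \<open>g\<close> needs a real tolerance. The gap \<open>e < a\<close> also restores the strict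
      inequality, since passing to the supremum yields only \<le>.\<close>
    then obtain e where e: "0 < ereal e" "ereal e < a"
      using ereal_dense2 by blast
    then have "\<forall>\<^sub>F \<eta> in at_right 0. dist (g \<eta>) L < e / 2"
      using L by (intro tendstoD) auto
    then obtain d where d: "d > 0" "\<And>\<eta>. 0 < \<eta> \<Longrightarrow> \<eta> < d \<Longrightarrow> dist (g \<eta>) L < e / 2"
      by (auto simp: eventually_at_right_field)
    have "oscillation_on {0<..\<epsilon>} g < a" if "0 < \<epsilon>" "\<epsilon> < d" for \<epsilon>
    proof -
      have "oscillation_on {0<..\<epsilon>} g \<le> ereal e"
      proof (rule oscillation_on_upper)
        fix y z assume "y \<in> {0<..\<epsilon>}" "z \<in> {0<..\<epsilon>}"
        then have "dist (g y) L < e / 2" "dist (g z) L < e / 2"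
          using d(2) that by auto
        then show "g y - g z \<le> e" unfolding dist_real_def by linarith
      qed (use that in auto)
      with e(2) show ?thesis by order
    qed
    then show "\<forall>\<^sub>F \<epsilon> in at_right 0. oscillation_on {0<..\<epsilon>} g < a"
      using d(1) by (auto simp: eventually_at_right_field)
  qed
next
  assume osc: "((\<lambda>\<epsilon>. oscillation_on {0<..\<epsilon>} g) \<longlongrightarrow> 0) (at_right 0)"
  have "cauchy_filter (filtermap g (at_right 0))"
    unfolding cauchy_filter_metric_filtermap
  proof (intro allI impI)
    fix e :: real assume "e > 0"
    then have "\<forall>\<^sub>F \<epsilon> in at_right 0. oscillation_on {0<..\<epsilon>} g < ereal e"
      using order_tendstoD(2)[OF osc, of "ereal e"] by simp
    then obtain d where d: "d > 0" "\<And>\<epsilon>. 0 < \<epsilon> \<Longrightarrow> \<epsilon> < d \<Longrightarrow> oscillation_on {0<..\<epsilon>} g < ereal e"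
      by (auto simp: eventually_at_right_field)
    \<comment> \<open>The single interval up to \<open>d / 2\<close>, whose endpoint lies strictly
      below \<open>d\<close>, controls all pairs of increments at once.\<close>
    define P where "P \<eta> \<longleftrightarrow> 0 < \<eta> \<and> \<eta> \<le> d / 2" for \<eta> :: real
    have diff: "g y - g z < e" if "P y" "P z" for y z
    proof -
      have "ereal (g y - g z) \<le> oscillation_on {0<..d / 2} g"
        using that by (intro oscillation_on_lower) (auto simp: P_def)
      also have "\<dots> < ereal e" using d by simp
      finally show ?thesis by simp
    qed
    have "eventually P (at_right 0)"
      unfolding eventually_at_right_field P_def using d(1)
      by (intro exI[of _ "d / 2"]) auto
    \<comment> \<open>Using \<open>diff\<close> for both orders of the pair bounds the absolute
      value.\<close>
    moreover have "\<forall>y z. P y \<and> P z \<longrightarrow> dist (g y) (g z) < e"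
      using diff by (auto simp: dist_real_def abs_less_iff)
    ultimately show "\<exists>P. eventually P (at_right 0) \<and> (\<forall>y z. P y \<and> P z \<longrightarrow> dist (g y) (g z) < e)"
      by blast
  qed
  moreover have "complete (UNIV :: real set)"
    by (simp add: complete_def Cauchy_convergent_iff convergent_def)
  \<comment> \<open>The image filter is proper because \<open>at_right 0\<close> is nontrivial on
    the reals. Its convergence to \<open>L\<close> is the definition of the limit of
    \<open>g\<close>.\<close>
  ultimately have "\<exists>L. filtermap g (at_right 0) \<le> nhds L"
    by (rule cauchy_filter_complete_converges) (simp_all add: filtermap_bot_iff)
  then show "\<exists>L. (g \<longlongrightarrow> L) (at_right 0)"
    by (simp add: filterlim_def)
qed

lemma frac_velocity_exists_iff_oscillation:
  "frac_velocity_exists s \<beta> f x \<longleftrightarrow> holder_oscillation_condition s \<beta> f x"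
  unfolding frac_velocity_exists_def has_frac_velocity_def holder_oscillation_condition_def
  by (rule convergent_at_right_0_iff_oscillation)

lemma frac_velocity_exists_imp_holder_continuous_at:
  assumes "frac_velocity_exists s \<beta> f x"
  shows "holder_continuous_at s \<beta> f x"
proof -
  from assms obtain L where L: "((\<lambda>\<epsilon>. frac_variation s \<beta> \<epsilon> f x) \<longlongrightarrow> L) (at_right 0)"
    unfolding frac_velocity_exists_def has_frac_velocity_def by blast
  from tendstoD[OF L, of 1]
  obtain d where d: "d > 0"
    "\<And>\<epsilon>. 0 < \<epsilon> \<Longrightarrow> \<epsilon> < d \<Longrightarrow> dist (frac_variation s \<beta> \<epsilon> f x) L < 1"
    by (auto simp: eventually_at_right_field)
  \<comment> \<open>Tolerance 1 around the limit gives the constant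
    \<open>\<bar>L\<bar> + 1\<close>, which is positive even when \<open>L = 0\<close>. Halving
    \<open>d\<close> allows the closed range of \<epsilon>.\<close>
  have "\<bar>incr s \<epsilon> f x\<bar> \<le> (\<bar>L\<bar> + 1) * \<epsilon> powr \<beta>" if "0 < \<epsilon>" "\<epsilon> \<le> d / 2" for \<epsilon>
  proof -
    have "\<bar>frac_variation s \<beta> \<epsilon> f x\<bar> \<le> \<bar>L\<bar> + 1"
      using d(2)[of \<epsilon>] that d(1) by (auto simp: dist_real_def)
    then show ?thesis
      using that by (simp add: frac_variation_def abs_divide divide_le_eq)
  qed
  then show ?thesis
    unfolding holder_continuous_at_def using d(1)
    by (intro exI[of _ "\<bar>L\<bar> + 1"] exI[of _ "d / 2"] conjI) auto
qed

text \<open>Each point of the one-sided interval is reached from \<open>x\<close> by an increment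
  \<eta> \<le> \<epsilon>, and monotonicity of the power replaces \<eta> by \<epsilon> in the
  Hoelder bound. Comparing two points through \<open>f x\<close> doubles the constant.\<close>

lemma holder_continuous_at_imp_growth:
  assumes "holder_continuous_at s \<beta> f x" and "\<beta> > 0"
  shows "holder_growth_condition s \<beta> f x"
proof -
  from assms(1) obtain C d where C: "C > 0" "d > 0"
    "\<And>\<epsilon>. 0 < \<epsilon> \<Longrightarrow> \<epsilon> \<le> d \<Longrightarrow> \<bar>incr s \<epsilon> f x\<bar> \<le> C * \<epsilon> powr \<beta>"
    unfolding holder_continuous_at_def by blast
  have "osc s \<epsilon> f x \<le> ereal (2 * C * \<epsilon> powr \<beta>)" if \<epsilon>: "0 < \<epsilon>" "\<epsilon> < d" for \<epsilon>
  proof -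
    \<comment> \<open>The value \<eta> = 0 stands for \<open>x\<close> itself, an endpoint of the
      closed interval; the Hoelder bound covers positive increments, but here the increment of
      \<open>f\<close> is 0.\<close>
    have incr_le: "\<bar>incr s \<eta> f x\<bar> \<le> C * \<epsilon> powr \<beta>" if "0 \<le> \<eta>" "\<eta> \<le> \<epsilon>" for \<eta>
    proof (cases "\<eta> = 0")
      case True
      then show ?thesis using C(1) by (cases s) auto
    next
      case False
      then have "\<bar>incr s \<eta> f x\<bar> \<le> C * \<eta> powr \<beta>" using C(3) that \<epsilon> by auto
      also have "\<dots> \<le> C * \<epsilon> powr \<beta>"
        using that C(1) assms(2) by (intro mult_left_mono powr_mono2) auto
      finally show ?thesis .
    qed
    show ?thesis
    proof (cases s)
      case Plus
      have bound: "\<bar>f y - f x\<bar> \<le> C * \<epsilon> powr \<beta>" if "y \<in> {x..x + \<epsilon>}" for y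
        using incr_le[of "y - x"] that Plus by simp
      have "f y - f z \<le> 2 * C * \<epsilon> powr \<beta>" if "y \<in> {x..x + \<epsilon>}" "z \<in> {x..x + \<epsilon>}" for y z
        using bound[OF that(1)] bound[OF that(2)] by linarith
      then show ?thesis using Plus \<epsilon> by (auto intro!: oscillation_on_upper)
    next
      case Minus
      have bound: "\<bar>f x - f y\<bar> \<le> C * \<epsilon> powr \<beta>" if "y \<in> {x - \<epsilon>..x}" for y
        using incr_le[of "x - y"] that Minus by simp
      have "f y - f z \<le> 2 * C * \<epsilon> powr \<beta>" if "y \<in> {x - \<epsilon>..x}" "z \<in> {x - \<epsilon>..x}" for y z
        using bound[OF that(1)] bound[OF that(2)] by linarith
      then show ?thesis using Minus \<epsilon> by (auto intro!: oscillation_on_upper)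
    qed
  qed
  then have "\<forall>\<^sub>F \<epsilon> in at_right 0. osc s \<epsilon> f x \<le> ereal (2 * C * \<epsilon> powr \<beta>)"
    using C(2) by (auto simp: eventually_at_right_field)
  then show ?thesis
    unfolding holder_growth_condition_def using C(1) by (intro exI[of _ "2 * C"]) auto
qed

theorem theorem1:
  fixes f :: "real \<Rightarrow> real" and x :: real
  shows "(\<forall>\<beta>>0.
            (frac_velocity_exists Plus \<beta> f x \<longrightarrow> holder_continuous_at Plus \<beta> f x) \<and>
            (frac_velocity_exists Minus \<beta> f x \<longrightarrow> holder_continuous_at Minus \<beta> f x))
       \<and> (\<forall>\<beta> s. 0 < \<beta> \<and> \<beta> \<le> 1 \<longrightarrow>
            holder_growth_condition s \<beta> f x \<and> holder_oscillation_condition s \<beta> f x \<longrightarrow>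
            frac_velocity_exists s \<beta> f x)
       \<and> (\<forall>\<beta> s. 0 < \<beta> \<and> \<beta> \<le> 1 \<longrightarrow>
            (frac_velocity_exists s \<beta> f x \<longleftrightarrow> holder_oscillation_condition s \<beta> f x) \<and>
            (frac_velocity_exists s \<beta> f x \<longrightarrow> holder_growth_condition s \<beta> f x))"
  \<comment> \<open>The Cauchy equivalence gives sufficiency and necessity of the oscillation
    condition; the growth condition is reached from existence by way of Hoelder continuity.\<close>
  using frac_velocity_exists_iff_oscillation frac_velocity_exists_imp_holder_continuous_at
    holder_continuous_at_imp_growth by blast

end
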